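(* Let $n,m,q\ge 1$ be integers, $K\in\,]0,+\infty]$, $\mathcal C\subseteq\mathbb R^m$ a closed convex cone, $A\subset\mathbb R^q$ a compact set, $\mathcal T_0\subseteq\mathbb R^{1+n+1+n}$ a closed set. Let $f\in C(\mathbb R^{1+n}\times A;\mathbb R^n)$ be such that $f(\cdot,a)$ is locally Lipschitz continuous on $\mathbb R^{1+n}$, uniformly with respect to $a\in A$, and let $g_1,\dots,g_m:\mathbb R^{1+n}\to\mathbb R^n$ and $h:\mathbb R^{1+n}\to\mathbb R$ be locally Lipschitz continuous. Let $\Psi:\mathbb R^{1+n+1+n+1}\to\mathbb R$ be such that $v_2\mapsto\Psi(t_1,x_1,t_2,x_2,v_2)$ is non-decreasing for every $(t_1,x_1,t_2,x_2)$. Let $\bar z=(\bar S,\bar\omega^0,\bar\omega,\bar\alpha,\bar y^0,\bar y,\bar\nu)$ be a feasible extended sense process, with $\Psi$ Lipschitz continuous on $(\bar y^0(0),\bar y(0),\bar y^0(\bar S),\bar y(\bar S),\bar\nu(\bar S))+\delta\mathbb B$ for some $\delta>0$, and suppose that $\bar z$ is an abnormal extremal, i.e. there exist multipliers $(p_0,p,\pi,\lambda,\mu)$ and functions $(m_0,m)$ meeting the Maximum Principle conditions (i)–(viii) listed in the context with $\lambda=0$. If $$\partial^{>}h(\bar y^0(0),\bar y(0))\cap\big(-\mathrm{proj}_{(t_1,x_1)}N_{\mathcal T_0}(\bar y^0(0),\bar y(0),\bar y^0(\bar S),\bar y(\bar S))\big)=\emptyset,$$ then $(p_0,p,\pi,0,\mu)$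 and $(m_0,m)$ verify the strengthened non-triviality condition $$\mu(]0,\bar S])+\|q_0\|_{L^\infty}+\|q\|_{L^\infty}\ne0\ \text{ if }\bar y^0(\bar S)=\bar y^0(0),\qquad \mu(]0,\bar S])+\|q\|_{L^\infty}\ne0\ \text{ if }\bar y^0(\bar S)>\bar y^0(0),$$ where $(q_0,q)$ is defined in the context.
   Context: **Notation.** $\mathbb B$ is the closed unit ball. $\mathcal T:=\mathcal T_0\times\,]-\infty,K]$ ($=\mathcal T_0\times\mathbb R$ if $K=+\infty$). $\mathbf C:=\{(\omega^0,\omega)\in[0,+\infty[\times\mathcal C:\ \omega^0+|\omega|=1\}$. Points of $\mathcal T_0$ are written $(t_1,x_1,t_2,x_2)$ and $\mathrm{proj}_{(t_1,x_1)}$ denotes projection on the first $1+n$ coordinates. **Extended sense processes.** An extended sense process is $(S,\omega^0,\omega,\alpha,y^0,y,\nu)$ with $S>0$, $(\omega^0,\omega,\alpha)\in L^1([0,S];\mathbf C\times A)$, $(y^0,y,\nu)\in W^{1,1}([0,S];\mathbb R^{1+n+1})$ and, for a.e. $s$, $\frac{dy^0}{ds}=\omega^0$, $\frac{dy}{ds}=f(y^0,y,\alpha)\omega^0+\sum_{j=1}^m g_j(y^0,y)\omega^j$, $\frac{d\nu}{ds}=|\omega|$. It is feasible if $\nu(0)=0$, $h(y^0(s),y(s))\le0$ for all $s\in[0,S]$, and $(y^0(0),y(0),y^0(S),y(S),\nu(S))\in\mathcal T$. **Nonsmooth analysis.** $N_D$ is the limiting normal cone, $\partial G$ the limiting subdifferential,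 $\partial_{x}G$ a partial limiting subdifferential, co the convex hull. For locally Lipschitz $G$: $\partial^{>}G(\bar x):=\mathrm{co}\{\xi:\exists x_i\to\bar x,\ G \text{ differentiable at } x_i,\ G(x_i)>0\ \forall i,\ \nabla G(x_i)\to\xi\}$. **Maximum Principle conditions.** $H(t,x,p_0,p,\pi,\omega^0,\omega,a):=p_0\omega^0+p\cdot(f(t,x,a)\omega^0+\sum_{i}g_i(t,x)\omega^i)+\pi|\omega|$. Multipliers $(p_0,p,\pi,\lambda,\mu)$ and functions $(m_0,m)$: $(p_0,p)\in W^{1,1}([0,\bar S];\mathbb R^{1+n})$, $\lambda\ge0$, $\pi\le0$, $\mu$ a finite nonnegative Borel measure on $[0,\bar S]$ (total mass $\|\mu\|_{TV}$), $(m_0,m):[0,\bar S]\to\mathbb R^{1+n}$ Borel measurable and $\mu$-integrable. Set $(q_0,q)(s):=(p_0,p)(s)+\int_{[0,s[}(m_0,m)\,d\mu$ for $s<\bar S$, $(q_0,q)(\bar S):=(p_0,p)(\bar S)+\int_{[0,\bar S]}(m_0,m)\,d\mu$, and $\bar e:=(\bar y^0(0),\bar y(0),\bar y^0(\bar S),\bar y(\bar S),\bar\nu(\bar S))$. The conditions are: (i) $\|p_0\|_{L^\infty}+\|p\|_{L^\infty}+\|\mu\|_{TV}+\lambda\ne0$; (ii) $(-\frac{dp_0}{ds},-\frac{dp}{ds})(s)\in\mathrm{co}\,\partial_{t,x}H(\bar y^0(s),\bar y(s),q_0(s),q(s),\pi,\bar\omega^0(s),\bar\omega(s),\bar\alpha(s))$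 a.e.; (iii) $(p_0(0),p(0),-q_0(\bar S),-q(\bar S),-\pi)\in\lambda\partial\Psi(\bar e)+N_{\mathcal T}(\bar e)$; (iv) for a.e. $s$, $H(\bar y^0,\bar y,q_0,q,\pi,\bar\omega^0,\bar\omega,\bar\alpha)(s)=\max_{(\omega^0,\omega,a)\in\mathbf C\times A}H(\bar y^0(s),\bar y(s),q_0(s),q(s),\pi,\omega^0,\omega,a)=0$; (v) $(m_0,m)(s)\in\partial^{>}h(\bar y^0(s),\bar y(s))$ for $\mu$-a.e. $s$; (vi) $\mathrm{spt}(\mu)\subseteq\{s:h(\bar y^0(s),\bar y(s))=0\}$; (vii) if $\lambda\partial_v\Psi(\bar e)=\{0\}$ and $\bar\nu(\bar S)<K$, then $\pi=0$ ($\partial_v$: partial subdifferential in the last variable); (viii) if $\bar y^0(0)<\bar y^0(\bar S)$, then $\|p\|_{L^\infty}+\|\mu\|_{TV}+\lambda\ne0$. (When $\lambda=0$, $\lambda\partial\Psi$ and $\lambda\partial_v\Psi$ mean $\{0\}$.) *)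

theory Defs
  imports "HOL-Analysis.Analysis" "HOL-Probability.Essential_Supremum"
begin

section \<open>Nonsmooth analysis\<close>

text \<open>At an isolated point of \<open>D\<close> the filter \<open>at x within D\<close> is \<open>bot\<close> and the \<open>Limsup\<close> is
  \<open>-\<infinity>\<close>, so every vector is a regular normal there, as it should be.\<close>

definition regular_normals :: "'a::euclidean_space set \<Rightarrow> 'a \<Rightarrow> 'a set" where
  "regular_normals D x =
     {\<eta>. Limsup (at x within D) (\<lambda>x'. ereal (\<eta> \<bullet> (x' - x) / norm (x' - x))) \<le> 0}"

definition limiting_normal_cone :: "'a::euclidean_space set \<Rightarrow> 'a \<Rightarrow> 'a set" where
  "limiting_normal_cone D x =
     {\<eta>. \<exists>X E. (\<forall>i. X i \<in> D \<and> E i \<in> regular_normals D (X i)) \<and>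
             X \<longlonglongrightarrow> x \<and> E \<longlonglongrightarrow> \<eta>}"

definition regular_subdiff :: "('a::euclidean_space \<Rightarrow> real) \<Rightarrow> 'a \<Rightarrow> 'a set" where
  "regular_subdiff G x =
     {\<xi>. Limsup (at x) (\<lambda>x'. ereal ((\<xi> \<bullet> (x' - x) - G x' + G x) / norm (x' - x))) \<le> 0}"

text \<open>The requirement \<open>G (X i) \<longlonglongrightarrow> G x\<close> is automatic wherever \<open>G\<close> is continuous at \<open>x\<close>.\<close>

definition limiting_subdiff :: "('a::euclidean_space \<Rightarrow> real) \<Rightarrow> 'a \<Rightarrow> 'a set" where
  "limiting_subdiff G x =
     {\<xi>. \<exists>X E. (\<forall>i. E i \<in> regular_subdiff G (X i)) \<and>
             X \<longlonglongrightarrow> x \<and> (\<lambda>i. G (X i)) \<longlonglongrightarrow> G x \<and> E \<longlonglongrightarrow> \<xi>}"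

text \<open>The set \<open>\<lambda> \<partial>G\<close>, with the convention that it is \<open>{0}\<close> for \<open>\<lambda> = 0\<close>, even if \<open>\<partial>G\<close> is empty.\<close>

definition scaled_subdiff :: "real \<Rightarrow> 'a::real_vector set \<Rightarrow> 'a set" where
  "scaled_subdiff l D = (if l = 0 then {0} else (\<lambda>\<xi>. l *\<^sub>R \<xi>) ` D)"

text \<open>The set \<open>\<partial>\<^sup>>G(x)\<close>.\<close>

definition hybrid_subdiff :: "('a::euclidean_space \<Rightarrow> real) \<Rightarrow> 'a \<Rightarrow> 'a set" where
  "hybrid_subdiff G x = convex hull
     {\<xi>. \<exists>X E. (\<forall>i. (GDERIV G (X i) :> E i) \<and> G (X i) > 0) \<and> X \<longlonglongrightarrow> x \<and> E \<longlonglongrightarrow> \<xi>}"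

definition locally_lipschitz :: "('a::metric_space \<Rightarrow> 'b::metric_space) \<Rightarrow> bool" where
  "locally_lipschitz F \<longleftrightarrow> (\<forall>x. \<exists>r>0. \<exists>L. L-lipschitz_on (cball x r) F)"

section \<open>Function spaces and measures\<close>

text \<open>\<open>y\<close> is the continuous representative of an element of \<open>W\<^sup>1\<^sup>,\<^sup>1([0,S])\<close> whose
  derivative in \<open>L\<^sup>1([0,S])\<close> is represented by \<open>v\<close> (so \<open>v\<close> is unique up to a null set).\<close>

definition has_W11_deriv :: "real \<Rightarrow> (real \<Rightarrow> 'a::euclidean_space) \<Rightarrow> (real \<Rightarrow> 'a) \<Rightarrow> bool" where
  "has_W11_deriv S y v \<longleftrightarrow>
     v absolutely_integrable_on {0..S} \<and> (\<forall>s\<in>{0..S}. y s = y 0 + integral {0..s} v)"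

definition Linf_norm :: "real \<Rightarrow> (real \<Rightarrow> 'a::real_normed_vector) \<Rightarrow> ennreal" where
  "Linf_norm S u = esssup (lebesgue_on {0..S}) (\<lambda>s. ennreal (norm (u s)))"

definition finite_borel_measure_on :: "real \<Rightarrow> real measure \<Rightarrow> bool" where
  "finite_borel_measure_on S \<mu> \<longleftrightarrow>
     sets \<mu> = sets (restrict_space borel {0..S}) \<and> finite_measure \<mu>"

definition spt :: "'a::topological_space measure \<Rightarrow> 'a set" where
  "spt \<mu> = {s \<in> space \<mu>. \<forall>U. open U \<and> s \<in> U \<longrightarrow> emeasure \<mu> (U \<inter> space \<mu>) > 0}"

section \<open>Extended sense processes\<close>

definition control_set :: "(real ^ 'm) set \<Rightarrow> (real \<times> (real ^ 'm)) set" where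
  "control_set C = {(w0, w). 0 \<le> w0 \<and> w \<in> C \<and> w0 + norm w = 1}"

definition endpoint_set ::
  "(real \<times> (real ^ 'n) \<times> real \<times> (real ^ 'n)) set \<Rightarrow> ereal \<Rightarrow>
   (real \<times> (real ^ 'n) \<times> real \<times> (real ^ 'n) \<times> real) set" where
  "endpoint_set T0 K = {(t1, x1, t2, x2, v). (t1, x1, t2, x2) \<in> T0 \<and> ereal v \<le> K}"

text \<open>Throughout, \<open>f (t, x) a\<close> is only meaningful for \<open>a \<in> A\<close>.\<close>

definition extended_sense_process ::
  "(real \<times> (real ^ 'n) \<Rightarrow> (real ^ 'q) \<Rightarrow> (real ^ 'n)) \<Rightarrow> ('m \<Rightarrow> real \<times> (real ^ 'n) \<Rightarrow> (real ^ 'n)) \<Rightarrow>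
   (real ^ 'm) set \<Rightarrow> (real ^ 'q) set \<Rightarrow>
   real \<Rightarrow> (real \<Rightarrow> real) \<Rightarrow> (real \<Rightarrow> (real ^ 'm)) \<Rightarrow> (real \<Rightarrow> (real ^ 'q)) \<Rightarrow>
   (real \<Rightarrow> real) \<Rightarrow> (real \<Rightarrow> (real ^ 'n)) \<Rightarrow> (real \<Rightarrow> real) \<Rightarrow> bool" where
  "extended_sense_process f g C A S \<omega>0 \<omega> \<alpha> y0 y \<nu> \<longleftrightarrow>
     S > 0 \<and>
     \<omega>0 absolutely_integrable_on {0..S} \<and>
     \<omega> absolutely_integrable_on {0..S} \<and>
     \<alpha> absolutely_integrable_on {0..S} \<and>
     (AE s in lebesgue_on {0..S}. (\<omega>0 s, \<omega> s) \<in> control_set C \<and> \<alpha> s \<in> A) \<and>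
     (\<exists>dy0 dy d\<nu>.
        has_W11_deriv S y0 dy0 \<and> has_W11_deriv S y dy \<and> has_W11_deriv S \<nu> d\<nu> \<and>
        (AE s in lebesgue_on {0..S}.
           dy0 s = \<omega>0 s \<and>
           dy s = \<omega>0 s *\<^sub>R f (y0 s, y s) (\<alpha> s) + (\<Sum>j\<in>UNIV. (\<omega> s $ j) *\<^sub>R g j (y0 s, y s)) \<and>
           d\<nu> s = norm (\<omega> s)))"

definition feasible ::
  "(real \<times> (real ^ 'n) \<Rightarrow> real) \<Rightarrow> (real \<times> (real ^ 'n) \<times> real \<times> (real ^ 'n)) set \<Rightarrow> ereal \<Rightarrow>
   real \<Rightarrow> (real \<Rightarrow> real) \<Rightarrow> (real \<Rightarrow> (real ^ 'n)) \<Rightarrow> (real \<Rightarrow> real) \<Rightarrow> bool" where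
  "feasible h T0 K S y0 y \<nu> \<longleftrightarrow>
     \<nu> 0 = 0 \<and>
     (\<forall>s\<in>{0..S}. h (y0 s, y s) \<le> 0) \<and>
     (y0 0, y 0, y0 S, y S, \<nu> S) \<in> endpoint_set T0 K"

section \<open>Maximum Principle\<close>

definition Hamiltonian ::
  "(real \<times> (real ^ 'n) \<Rightarrow> (real ^ 'q) \<Rightarrow> (real ^ 'n)) \<Rightarrow> ('m \<Rightarrow> real \<times> (real ^ 'n) \<Rightarrow> (real ^ 'n)) \<Rightarrow>
   real \<times> (real ^ 'n) \<Rightarrow> real \<Rightarrow> (real ^ 'n) \<Rightarrow> real \<Rightarrow> real \<Rightarrow> (real ^ 'm) \<Rightarrow> (real ^ 'q) \<Rightarrow> real" where
  "Hamiltonian f g z p0 p \<pi> w0 w a =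
     p0 * w0 + p \<bullet> (w0 *\<^sub>R f z a + (\<Sum>j\<in>UNIV. (w $ j) *\<^sub>R g j z)) + \<pi> * norm w"

text \<open>The function \<open>q\<close> (resp. \<open>q\<^sub>0\<close>) obtained from \<open>p\<close> and \<open>m\<close> (resp. \<open>p\<^sub>0\<close> and \<open>m\<^sub>0\<close>).\<close>

definition shifted_costate ::
  "real \<Rightarrow> real measure \<Rightarrow> (real \<Rightarrow> 'a::euclidean_space) \<Rightarrow> (real \<Rightarrow> 'a) \<Rightarrow> real \<Rightarrow> 'a" where
  "shifted_costate S \<mu> p m s =
     (if s < S then p s + (LINT r:{0..<s}|\<mu>. m r) else p S + (LINT r:{0..S}|\<mu>. m r))"

definition maximum_principle ::
  "(real \<times> (real ^ 'n) \<Rightarrow> (real ^ 'q) \<Rightarrow> (real ^ 'n)) \<Rightarrow> ('m \<Rightarrow> real \<times> (real ^ 'n) \<Rightarrow> (real ^ 'n)) \<Rightarrow>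
   (real \<times> (real ^ 'n) \<Rightarrow> real) \<Rightarrow> (real \<times> (real ^ 'n) \<times> real \<times> (real ^ 'n) \<times> real \<Rightarrow> real) \<Rightarrow>
   (real ^ 'm) set \<Rightarrow> (real ^ 'q) set \<Rightarrow> (real \<times> (real ^ 'n) \<times> real \<times> (real ^ 'n)) set \<Rightarrow> ereal \<Rightarrow>
   real \<Rightarrow> (real \<Rightarrow> real) \<Rightarrow> (real \<Rightarrow> (real ^ 'm)) \<Rightarrow> (real \<Rightarrow> (real ^ 'q)) \<Rightarrow>
   (real \<Rightarrow> real) \<Rightarrow> (real \<Rightarrow> (real ^ 'n)) \<Rightarrow> (real \<Rightarrow> real) \<Rightarrow>
   (real \<Rightarrow> real) \<Rightarrow> (real \<Rightarrow> (real ^ 'n)) \<Rightarrow> real \<Rightarrow> real \<Rightarrow> real measure \<Rightarrow>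
   (real \<Rightarrow> real) \<Rightarrow> (real \<Rightarrow> (real ^ 'n)) \<Rightarrow> bool" where
  "maximum_principle f g h \<Psi> C A T0 K S \<omega>0 \<omega> \<alpha> y0 y \<nu> p0 p \<pi> l \<mu> m0 m \<longleftrightarrow>
    (let q0 = shifted_costate S \<mu> p0 m0;
         q = shifted_costate S \<mu> p m;
         e = (y0 0, y 0, y0 S, y S, \<nu> S);
         dv\<Psi> = limiting_subdiff (\<lambda>v. \<Psi> (y0 0, y 0, y0 S, y S, v)) (\<nu> S)
     in
     l \<ge> 0 \<and> \<pi> \<le> 0 \<and>
     finite_borel_measure_on S \<mu> \<and> integrable \<mu> m0 \<and> integrable \<mu> m \<and>
     Linf_norm S p0 + Linf_norm S p + emeasure \<mu> {0..S} + ennreal l \<noteq> 0 \<and>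
     (\<exists>dp0 dp. has_W11_deriv S p0 dp0 \<and> has_W11_deriv S p dp \<and>
        (AE s in lebesgue_on {0..S}.
           (- dp0 s, - dp s) \<in> convex hull
             limiting_subdiff (\<lambda>z. Hamiltonian f g z (q0 s) (q s) \<pi> (\<omega>0 s) (\<omega> s) (\<alpha> s)) (y0 s, y s))) \<and>
     (p0 0, p 0, - q0 S, - q S, - \<pi>) \<in>
       {a + b | a b. a \<in> scaled_subdiff l (limiting_subdiff \<Psi> e) \<and>
                     b \<in> limiting_normal_cone (endpoint_set T0 K) e} \<and>
     (AE s in lebesgue_on {0..S}.
        Hamiltonian f g (y0 s, y s) (q0 s) (q s) \<pi> (\<omega>0 s) (\<omega> s) (\<alpha> s) = 0 \<and>
        (\<forall>(w0, w)\<in>control_set C. \<forall>a\<in>A.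
           Hamiltonian f g (y0 s, y s) (q0 s) (q s) \<pi> w0 w a
             \<le> Hamiltonian f g (y0 s, y s) (q0 s) (q s) \<pi> (\<omega>0 s) (\<omega> s) (\<alpha> s))) \<and>
     (AE s in \<mu>. (m0 s, m s) \<in> hybrid_subdiff h (y0 s, y s)) \<and>
     spt \<mu> \<subseteq> {s \<in> {0..S}. h (y0 s, y s) = 0} \<and>
     (scaled_subdiff l dv\<Psi> = {0} \<and> ereal (\<nu> S) < K \<longrightarrow> \<pi> = 0) \<and>
     (y0 0 < y0 S \<longrightarrow> Linf_norm S p + emeasure \<mu> {0..S} + ennreal l \<noteq> 0))"

end

theory Submission
  imports Defs
begin

text \<open>
  Suppose that the strengthened condition fails. Then \<open>\<mu>\<close> is carried by the point \<open>0\<close>, where it has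
  some mass \<open>M \<ge> 0\<close>, and \<open>q = 0\<close> almost everywhere. On \<open>]0, S]\<close> the costate is
  \<open>q = p + M m(0)\<close>, and \<open>p\<close> is continuous, so \<open>p\<close> is the constant \<open>- M m(0)\<close> on all of \<open>[0, S]\<close>
  (lemma \<open>costate_eq_if_shifted_costate_AE_0\<close>).

  The same holds for \<open>p\<^sub>0\<close>. If \<open>y\<^sup>0(S) = y\<^sup>0(0)\<close>, then the failure of the condition also gives
  \<open>q\<^sub>0 = 0\<close> almost everywhere, and the argument just given applies to \<open>p\<^sub>0\<close>. If
  \<open>y\<^sup>0(S) > y\<^sup>0(0)\<close>, then \<open>q\<^sub>0 = 0\<close> comes from the Hamiltonian. As \<open>q = 0\<close>, the Hamiltonian is
  \<open>q\<^sub>0 \<omega>\<^sup>0 + \<pi> |\<omega>|\<close>, which does not depend on \<open>(t, x)\<close>; so the adjoint inclusion forces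
  \<open>p\<^sub>0' = 0\<close>, and \<open>q\<^sub>0\<close> is constant on \<open>]0, S]\<close>. Since \<open>y\<^sup>0(S) > y\<^sup>0(0)\<close>, \<open>\<omega>\<^sup>0 > 0\<close> on a set of
  positive measure. Comparing with the control \<open>(1, 0)\<close> in the maximum condition gives
  \<open>q\<^sub>0 \<le> 0\<close>; hence both terms of \<open>q\<^sub>0 \<omega>\<^sup>0 + \<pi> |\<omega>| = 0\<close> are nonpositive, and \<open>q\<^sub>0 = 0\<close> where
  \<open>\<omega>\<^sup>0 > 0\<close>.

  If \<open>M = 0\<close>, then \<open>p\<^sub>0\<close>, \<open>p\<close>, \<open>\<mu>\<close> and \<open>\<lambda>\<close> all vanish, against non-triviality. So \<open>M > 0\<close>. As
  \<open>q\<^sub>0(S) = 0\<close> and \<open>q(S) = 0\<close>, the transversality condition says that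
  \<open>(- M m\<^sub>0(0), - M m(0), 0, 0, - \<pi>)\<close> is a normal to the endpoint set. Its first four components
  are a normal to \<open>T0\<close> (lemma \<open>limiting_normal_cone_endpoint_set\<close>), and this remains true after
  division by \<open>M\<close> (lemma \<open>limiting_normal_cone_scaleR\<close>). Since \<open>\<mu>\<close> charges \<open>0\<close>, the vector
  \<open>(m\<^sub>0, m)(0)\<close> belongs to \<open>\<partial>\<^sup>>h\<close> at the initial point, which contradicts the constraint
  qualification.
\<close>

section \<open>Normal cones and subdifferentials\<close>

lemma Limsup_ereal_le_0_iff:
  fixes u :: "'a \<Rightarrow> real"
  shows "Limsup F (\<lambda>x. ereal (u x)) \<le> 0 \<longleftrightarrow> (\<forall>e>0. eventually (\<lambda>x. u x < e) F)"
proof -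
  have "(\<forall>y>0. eventually (\<lambda>x. ereal (u x) < y) F)"
    if *: "\<forall>e>0. eventually (\<lambda>x. u x < e) F"
  proof (intro allI impI)
    fix y :: ereal assume "0 < y"
    then obtain e where e: "0 < ereal e" "ereal e < y"
      using ereal_dense2 by blast
    then have "eventually (\<lambda>x. u x < e) F"
      using * by simp
    then show "eventually (\<lambda>x. ereal (u x) < y) F"
      by (rule eventually_mono) (use e(2) in \<open>auto intro: less_trans[of _ "ereal e"]\<close>)
  qed
  moreover have "eventually (\<lambda>x. u x < e) F"
    if "\<forall>y>0. eventually (\<lambda>x. ereal (u x) < y) F" "e > 0" for e
    using that(1)[rule_format, of "ereal e"] that(2) by simp
  ultimately show ?thesis
    unfolding Limsup_le_iff by blast
qed

lemma mem_regular_normals_iff: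
  "\<eta> \<in> regular_normals D x \<longleftrightarrow>
     (\<forall>e>0. \<exists>d>0. \<forall>x'\<in>D. x' \<noteq> x \<and> dist x' x < d \<longrightarrow> \<eta> \<bullet> (x' - x) / norm (x' - x) < e)"
  by (simp add: regular_normals_def Limsup_ereal_le_0_iff eventually_at)

lemma limiting_normal_cone_scaleR:
  assumes "\<eta> \<in> limiting_normal_cone D x" "c > 0"
  shows "c *\<^sub>R \<eta> \<in> limiting_normal_cone D x"
proof -
  have regular: "c *\<^sub>R \<xi> \<in> regular_normals D x'" if "\<xi> \<in> regular_normals D x'" for \<xi> x'
    unfolding mem_regular_normals_iff
  proof (intro allI impI)
    fix e :: real assume "e > 0"
    then have "e / c > 0" using \<open>c > 0\<close> by simp
    with that obtain d where d: "d > 0"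
      "\<forall>z\<in>D. z \<noteq> x' \<and> dist z x' < d \<longrightarrow> \<xi> \<bullet> (z - x') / norm (z - x') < e / c"
      unfolding mem_regular_normals_iff by blast
    have "(c *\<^sub>R \<xi>) \<bullet> (z - x') / norm (z - x') < e"
      if "z \<in> D" "z \<noteq> x'" "dist z x' < d" for z
    proof -
      have "c * (\<xi> \<bullet> (z - x') / norm (z - x')) < c * (e / c)"
        using d(2) that \<open>c > 0\<close> by (intro mult_strict_left_mono) auto
      then show ?thesis using \<open>c > 0\<close> by simp
    qed
    then show "\<exists>d>0. \<forall>z\<in>D. z \<noteq> x' \<and> dist z x' < d \<longrightarrow>
        (c *\<^sub>R \<xi>) \<bullet> (z - x') / norm (z - x') < e"
      using d(1) by blast
  qed
  obtain X E where "\<forall>i. X i \<in> D \<and> E i \<in> regular_normals D (X i)" "X \<longlonglongrightarrow> x" "E \<longlonglongrightarrow> \<eta>"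
    using assms(1) unfolding limiting_normal_cone_def by auto
  then show ?thesis
    unfolding limiting_normal_cone_def mem_Collect_eq using regular
    by (intro exI[of _ X] exI[of _ "\<lambda>i. c *\<^sub>R E i"]) (auto intro: tendsto_scaleR)
qed

text \<open>Every slice of the endpoint set at a fixed \<open>v \<le> K\<close> is a copy of \<open>T0\<close>. Testing a regular normal
  only along such a slice kills its last component; this passes to the limit.\<close>

lemma limiting_normal_cone_endpoint_set:
  fixes T0 :: "(real \<times> (real ^ 'n) \<times> real \<times> (real ^ 'n)) set"
  assumes "(a, b, c, d, k) \<in> limiting_normal_cone (endpoint_set T0 K) (t1, x1, t2, x2, v)"
  shows "(a, b, c, d) \<in> limiting_normal_cone T0 (t1, x1, t2, x2)"
proof -
  define P :: "real \<times> (real ^ 'n) \<times> real \<times> (real ^ 'n) \<times> real \<Rightarrow> real \<times> (real ^ 'n) \<times> real \<times> (real ^ 'n)"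
    where "P z = (fst z, fst (snd z), fst (snd (snd z)), fst (snd (snd (snd z))))" for z
  have P_tendsto: "(\<lambda>i. P (X i)) \<longlonglongrightarrow> P z" if "X \<longlonglongrightarrow> z" for X z
    unfolding P_def using that by (intro tendsto_intros)
  have P_endpoint: "P z \<in> T0" if "z \<in> endpoint_set T0 K" for z
    using that by (auto simp: P_def endpoint_set_def)
  have regular: "P \<eta> \<in> regular_normals T0 (P z)"
    if \<eta>: "\<eta> \<in> regular_normals (endpoint_set T0 K) z" and z: "z \<in> endpoint_set T0 K" for \<eta> z
    unfolding mem_regular_normals_iff
  proof (intro allI impI)
    fix e :: real assume "e > 0"
    then obtain r where r: "r > 0" "\<And>z'. z' \<in> endpoint_set T0 K \<Longrightarrow> z' \<noteq> z \<Longrightarrow> dist z' z < r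
        \<Longrightarrow> \<eta> \<bullet> (z' - z) / norm (z' - z) < e"
      using \<eta> unfolding mem_regular_normals_iff by meson
    have "P \<eta> \<bullet> (u - P z) / norm (u - P z) < e" if u: "u \<in> T0" "u \<noteq> P z" "dist u (P z) < r" for u
    proof -
      obtain s1 w1 s2 w2 where u_eq: "u = (s1, w1, s2, w2)" by (cases u) auto
      obtain s1' w1' s2' w2' k' where z_eq: "z = (s1', w1', s2', w2', k')" by (cases z) auto
      obtain h1 h2 h3 h4 h5 where \<eta>_eq: "\<eta> = (h1, h2, h3, h4, h5)" by (cases \<eta>) auto
      let ?z = "(s1, w1, s2, w2, k')"
      have "?z \<in> endpoint_set T0 K" "?z \<noteq> z"
        using u z by (auto simp: u_eq z_eq P_def endpoint_set_def)
      moreover have n: "norm (?z - z) = norm (u - P z)" "\<eta> \<bullet> (?z - z) = P \<eta> \<bullet> (u - P z)"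
        by (simp_all add: u_eq z_eq \<eta>_eq P_def norm_Pair)
      ultimately show ?thesis
        using r(2)[of ?z] u(3) by (simp add: dist_norm)
    qed
    then show "\<exists>d>0. \<forall>u\<in>T0. u \<noteq> P z \<and> dist u (P z) < d \<longrightarrow>
        P \<eta> \<bullet> (u - P z) / norm (u - P z) < e"
      using r(1) by blast
  qed
  obtain X E where XE: "\<And>i. X i \<in> endpoint_set T0 K"
      "\<And>i. E i \<in> regular_normals (endpoint_set T0 K) (X i)"
      "X \<longlonglongrightarrow> (t1, x1, t2, x2, v)" "E \<longlonglongrightarrow> (a, b, c, d, k)"
    using assms unfolding limiting_normal_cone_def by auto
  have "P (a, b, c, d, k) \<in> limiting_normal_cone T0 (P (t1, x1, t2, x2, v))"
    unfolding limiting_normal_cone_def mem_Collect_eq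
    using XE regular P_endpoint P_tendsto
    by (intro exI[of _ "\<lambda>i. P (X i)"] exI[of _ "\<lambda>i. P (E i)"]) auto
  then show ?thesis by (simp add: P_def)
qed

text \<open>Moving from \<open>x\<close> in the direction of a regular subgradient \<open>\<xi>\<close> of a constant function gives
  the difference quotient \<open>norm \<xi>\<close>.\<close>

lemma limiting_subdiff_const_subset: "limiting_subdiff (\<lambda>_. k) x \<subseteq> {0}"
proof -
  have regular: "\<xi> = 0" if \<xi>: "\<xi> \<in> regular_subdiff (\<lambda>_. k) z" for \<xi> z :: 'a
  proof (rule ccontr)
    assume "\<xi> \<noteq> 0"
    moreover have "\<forall>e>0. \<exists>d>0. \<forall>z'. z' \<noteq> z \<and> dist z' z < d \<longrightarrow> \<xi> \<bullet> (z' - z) / norm (z' - z) < e"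
      using \<xi> by (simp add: regular_subdiff_def Limsup_ereal_le_0_iff eventually_at)
    ultimately obtain d where d: "d > 0"
      "\<And>z'. z' \<noteq> z \<Longrightarrow> dist z' z < d \<Longrightarrow> \<xi> \<bullet> (z' - z) / norm (z' - z) < norm \<xi>"
      by (meson zero_less_norm_iff)
    \<comment> \<open>The displacement \<open>?t *\<^sub>R \<xi>\<close> has length \<open>d / 2 < d\<close>.\<close>
    let ?t = "d / 2 / norm \<xi>"
    have "\<xi> \<bullet> (?t *\<^sub>R \<xi>) / norm (?t *\<^sub>R \<xi>) = norm \<xi>"
      using \<open>\<xi> \<noteq> 0\<close> d(1) by (simp add: dot_square_norm power2_eq_square)
    moreover have "z + ?t *\<^sub>R \<xi> \<noteq> z" "dist (z + ?t *\<^sub>R \<xi>) z < d"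
      using \<open>\<xi> \<noteq> 0\<close> d(1) by (auto simp: dist_norm)
    ultimately show False
      using d(2)[of "z + ?t *\<^sub>R \<xi>"] by simp
  qed
  show ?thesis
  proof
    fix \<xi> assume "\<xi> \<in> limiting_subdiff (\<lambda>_. k) x"
    then obtain X E where "\<forall>i. E i \<in> regular_subdiff (\<lambda>_. k) (X i)" "E \<longlonglongrightarrow> \<xi>"
      unfolding limiting_subdiff_def by auto
    then have "E = (\<lambda>_. 0)" using regular by blast
    then show "\<xi> \<in> {0}" using \<open>E \<longlonglongrightarrow> \<xi>\<close> by (simp add: LIMSEQ_const_iff)
  qed
qed

section \<open>Absolutely continuous functions\<close>

lemma has_W11_deriv_continuous_on:
  assumes "has_W11_deriv S u v"
  shows "continuous_on {0..S} u"
proof -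
  have "continuous_on {0..S} (\<lambda>s. u 0 + integral {0..s} v)"
    using assms unfolding has_W11_deriv_def
    by (intro continuous_intros indefinite_integral_continuous_1)
       (auto dest: set_lebesgue_integral_eq_integral(1))
  then show ?thesis
    using assms unfolding has_W11_deriv_def by (metis (no_types, lifting) continuous_on_cong)
qed

lemma has_W11_deriv_AE_0_imp_const:
  assumes "has_W11_deriv S u v" "AE s in lebesgue_on {0..S}. v s = 0" "s \<in> {0..S}"
  shows "u s = u 0"
proof -
  have "AE s in lebesgue. s \<in> {0..S} \<longrightarrow> v s = 0"
    using assms(2) by (simp add: AE_restrict_space_iff)
  then obtain N where N: "N \<in> null_sets lebesgue" "\<And>r. r \<in> {0..S} - N \<Longrightarrow> v r = 0"
    by (rule AE_E3) auto
  have "(v has_integral 0) {0..s}"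
    using N assms(3) by (intro has_integral_negligible[of N]) (auto simp: negligible_iff_null_sets)
  then show ?thesis
    using assms(1,3) unfolding has_W11_deriv_def by (metis add.right_neutral integral_unique)
qed

lemma AE_lebesgue_on_neq: "AE s in lebesgue_on {0..S}. s \<noteq> c" for S c :: real
proof -
  have "AE s in lebesgue. s \<noteq> c"
    by (rule AE_completion[OF AE_lborel_singleton])
  then show ?thesis
    by (auto simp: AE_restrict_space_iff)
qed

lemma continuous_on_AE_eq_const:
  fixes u :: "real \<Rightarrow> 'a::t2_space"
  assumes "continuous_on {0..S} u" "AE s in lebesgue_on {0..S}. u s = c" "0 < S" "s \<in> {0..S}"
  shows "u s = c"
proof -
  let ?C = "{s \<in> {0..S}. u s = c}"
  have closed: "closed ?C"
    using continuous_closed_preimage_constant[OF assms(1)] by simp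
  have "AE s\<in>{0<..<S} in lebesgue. s \<in> ?C"
    using assms(2) by (auto simp: AE_restrict_space_iff elim!: eventually_mono)
  then have "{0<..<S} \<subseteq> ?C"
    using mem_closed_if_AE_lebesgue_open[OF open_greaterThanLessThan closed] by blast
  then have "closure {0<..<S} \<subseteq> ?C"
    using closed by (rule closure_minimal)
  then show ?thesis
    using assms(3,4) by auto
qed

lemma Linf_norm_eq_0_imp_AE:
  "Linf_norm S u = 0 \<Longrightarrow> AE s in lebesgue_on {0..S}. u s = 0"
  using esssup_AE[where M = "lebesgue_on {0..S}" and f = "\<lambda>s. ennreal (norm (u s))"]
  by (simp add: Linf_norm_def)

lemma Linf_norm_eq_0I:
  assumes "\<And>s. s \<in> {0..S} \<Longrightarrow> u s = 0"
  shows "Linf_norm S u = 0"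
proof -
  have "(\<lambda>s. ennreal (norm (u s))) \<in> borel_measurable (lebesgue_on {0..S})"
    using assms by (subst measurable_cong[where g = "\<lambda>_. 0"]) auto
  then have "Linf_norm S u \<le> 0"
    unfolding Linf_norm_def using assms by (intro esssup_I AE_I2) auto
  then show ?thesis by simp
qed

section \<open>Measures carried by the initial time\<close>

lemma finite_borel_measure_on_simps:
  assumes "finite_borel_measure_on S \<mu>"
  shows "space \<mu> = {0..S}" "A \<in> sets \<mu> \<longleftrightarrow> A \<subseteq> {0..S} \<and> A \<in> sets borel"
proof -
  have sets: "sets \<mu> = sets (restrict_space borel {0..S})"
    using assms by (simp add: finite_borel_measure_on_def)
  show "space \<mu> = {0..S}"
    using sets_eq_imp_space_eq[OF sets] by (simp add: space_restrict_space)
  show "A \<in> sets \<mu> \<longleftrightarrow> A \<subseteq> {0..S} \<and> A \<in> sets borel"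
    unfolding sets by (subst sets_restrict_space_iff) auto
qed

lemma AE_eq_0_if_no_mass_after_0:
  assumes "finite_borel_measure_on S \<mu>" "emeasure \<mu> {0<..S} = 0"
  shows "AE r in \<mu>. r = 0"
proof (rule AE_I)
  show "{r \<in> space \<mu>. r \<noteq> 0} \<subseteq> {0<..S}" "{0<..S} \<in> sets \<mu>"
    by (auto simp: finite_borel_measure_on_simps[OF assms(1)])
qed (fact assms(2))

lemma shifted_costate_if_no_mass_after_0:
  assumes \<mu>: "finite_borel_measure_on S \<mu>" "emeasure \<mu> {0<..S} = 0"
    and m: "integrable \<mu> m" and s: "0 < s" "s \<le> S"
  shows "shifted_costate S \<mu> p m s = p s + measure \<mu> {0..S} *\<^sub>R m 0"
proof -
  interpret finite_measure \<mu>
    using \<mu>(1) by (simp add: finite_borel_measure_on_def)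
  have int: "(LINT r:A|\<mu>. m r) = measure \<mu> {0..S} *\<^sub>R m 0" if "0 \<in> A" "A \<in> sets \<mu>" for A
  proof -
    have "(LINT r:A|\<mu>. m r) = (LINT r|\<mu>. m 0)"
      unfolding set_lebesgue_integral_def
      using AE_eq_0_if_no_mass_after_0[OF \<mu>] that m
      by (intro integral_cong_AE) (auto elim!: eventually_mono)
    then show ?thesis
      by (simp add: finite_borel_measure_on_simps[OF \<mu>(1)])
  qed
  show ?thesis
    using s int[of "{0..<s}"] int[of "{0..S}"]
    by (cases "s = S")
       (auto simp: shifted_costate_def finite_borel_measure_on_simps(2)[OF \<mu>(1)] subset_eq)
qed

text \<open>On \<open>]0, S]\<close> the shifted costate is \<open>p\<close> plus a constant. If it vanishes almost everywhere, then
  the continuous function \<open>p\<close> is minus this constant, also at \<open>0\<close>, where the shifted costate has not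
  yet seen the atom of \<open>\<mu>\<close>.\<close>

lemma costate_eq_if_shifted_costate_AE_0:
  assumes \<mu>: "finite_borel_measure_on S \<mu>" "emeasure \<mu> {0<..S} = 0"
    and m: "integrable \<mu> m" and p: "has_W11_deriv S p dp"
    and q: "AE s in lebesgue_on {0..S}. shifted_costate S \<mu> p m s = 0"
    and S: "0 < S" and s: "s \<in> {0..S}"
  shows "p s = - (measure \<mu> {0..S} *\<^sub>R m 0)"
proof (rule continuous_on_AE_eq_const[OF has_W11_deriv_continuous_on[OF p] _ S s])
  show "AE s in lebesgue_on {0..S}. p s = - (measure \<mu> {0..S} *\<^sub>R m 0)"
    using AE_lebesgue_on_neq[of 0 S] q AE_space
  proof eventually_elim
    case (elim s)
    then show ?case
      using shifted_costate_if_no_mass_after_0[OF \<mu> m, of s p]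
      by (simp add: eq_neg_iff_add_eq_0 space_restrict_space)
  qed
qed

text \<open>If \<open>q = 0\<close>, the Hamiltonian depends on neither time nor state. So the adjoint inclusion
  freezes \<open>p\<^sub>0\<close>, and the maximum condition at one instant with \<open>\<omega>\<^sup>0 > 0\<close> determines its value.\<close>

lemma time_costate_eq_if_shifted_costate_AE_0:
  fixes f :: "real \<times> (real ^ 'n) \<Rightarrow> (real ^ 'q) \<Rightarrow> (real ^ 'n)"
    and g :: "'m::finite \<Rightarrow> real \<times> (real ^ 'n) \<Rightarrow> (real ^ 'n)"
  assumes process: "extended_sense_process f g C A S \<omega>0 \<omega> \<alpha> y0 y \<nu>"
    and mp: "maximum_principle f g h \<Psi> C A T0 K S \<omega>0 \<omega> \<alpha> y0 y \<nu> p0 p \<pi> l \<mu> m0 m"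
    and C: "cone C" and \<mu>: "emeasure \<mu> {0<..S} = 0"
    and q: "AE s in lebesgue_on {0..S}. shifted_costate S \<mu> p m s = 0"
    and y0: "y0 0 < y0 S" and s: "s \<in> {0..S}"
  shows "p0 s = - (measure \<mu> {0..S} *\<^sub>R m0 0)"
proof -
  let ?qt = "shifted_costate S \<mu> p0 m0" and ?qx = "shifted_costate S \<mu> p m"
  have \<mu>_borel: "finite_borel_measure_on S \<mu>" and m0: "integrable \<mu> m0" and \<pi>: "\<pi> \<le> 0"
    using mp unfolding maximum_principle_def Let_def by blast+
  obtain dp0 dp where dp0: "has_W11_deriv S p0 dp0"
    and adj: "AE s in lebesgue_on {0..S}. (- dp0 s, - dp s) \<in> convex hull
      limiting_subdiff (\<lambda>z. Hamiltonian f g z (?qt s) (?qx s) \<pi> (\<omega>0 s) (\<omega> s) (\<alpha> s)) (y0 s, y s)"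
    using mp unfolding maximum_principle_def Let_def by blast
  have max: "AE s in lebesgue_on {0..S}.
      Hamiltonian f g (y0 s, y s) (?qt s) (?qx s) \<pi> (\<omega>0 s) (\<omega> s) (\<alpha> s) = 0 \<and>
      (\<forall>(w0, w)\<in>control_set C. \<forall>a\<in>A. Hamiltonian f g (y0 s, y s) (?qt s) (?qx s) \<pi> w0 w a
         \<le> Hamiltonian f g (y0 s, y s) (?qt s) (?qx s) \<pi> (\<omega>0 s) (\<omega> s) (\<alpha> s))"
    using mp unfolding maximum_principle_def Let_def by blast
  have control: "AE s in lebesgue_on {0..S}. (\<omega>0 s, \<omega> s) \<in> control_set C \<and> \<alpha> s \<in> A"
    using process unfolding extended_sense_process_def by blast
  obtain dy0 where dy0: "has_W11_deriv S y0 dy0" "AE s in lebesgue_on {0..S}. dy0 s = \<omega>0 s"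
    using process unfolding extended_sense_process_def by (fastforce elim: eventually_mono)
  have S: "0 < S"
    using process unfolding extended_sense_process_def by blast
  have "AE s in lebesgue_on {0..S}. dp0 s = 0"
    using adj q
  proof eventually_elim
    case (elim s)
    have "convex hull limiting_subdiff
        (\<lambda>z. Hamiltonian f g z (?qt s) (?qx s) \<pi> (\<omega>0 s) (\<omega> s) (\<alpha> s)) (y0 s, y s) \<subseteq> {0}"
      using elim(2) hull_mono[OF limiting_subdiff_const_subset, of convex]
      by (simp add: Hamiltonian_def)
    then show ?case
      using elim(1) by (auto simp: zero_prod_def)
  qed
  then have p0: "p0 s = p0 0" if "s \<in> {0..S}" for s
    using has_W11_deriv_AE_0_imp_const[OF dp0] that by blast
  have "\<exists>s\<in>{0<..S}. ?qt s = 0"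
  proof (rule ccontr)
    assume *: "\<not> ?thesis"
    have "AE s in lebesgue_on {0..S}. dy0 s = 0"
      using AE_lebesgue_on_neq[of 0 S] max control q dy0(2) AE_space
    proof eventually_elim
      case (elim s)
      have zero: "?qt s * \<omega>0 s + \<pi> * norm (\<omega> s) = 0"
        and le: "?qt s * w0 + \<pi> * norm w \<le> 0" if "(w0, w) \<in> control_set C" for w0 w
        using elim that by (fastforce simp: Hamiltonian_def)+
      \<comment> \<open>The cone is nonempty, so it contains \<open>0\<close>, and the control \<open>(1, 0)\<close> is a competitor.\<close>
      have "(0::real) *\<^sub>R \<omega> s \<in> C"
        using elim(3) C unfolding cone_def control_set_def by blast
      then have "?qt s \<le> 0"
        using le[of 1 0] by (simp add: control_set_def)
      moreover have "?qt s \<noteq> 0"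
        using * elim(1,6) by (auto simp: space_restrict_space)
      moreover have "0 \<le> \<omega>0 s"
        using elim(3) by (simp add: control_set_def)
      moreover have "\<pi> * norm (\<omega> s) \<le> 0"
        using \<pi> by (simp add: mult_nonpos_nonneg)
      ultimately have "\<omega>0 s = 0"
        using zero elim(3) mult_neg_pos[of "?qt s" "\<omega>0 s"] by fastforce
      then show ?case using elim(5) by simp
    qed
    then show False
      using has_W11_deriv_AE_0_imp_const[OF dy0(1), of S] y0 S by simp
  qed
  then obtain r where "r \<in> {0<..S}" "?qt r = 0" by blast
  then have "p0 r + measure \<mu> {0..S} *\<^sub>R m0 0 = 0"
    using shifted_costate_if_no_mass_after_0[OF \<mu>_borel \<mu> m0, of r p0] by simp
  then show ?thesis
    using p0[OF s] p0[of r] \<open>r \<in> {0<..S}\<close> by simp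
qed

section \<open>The strengthened non-triviality condition\<close>

theorem proposition3p1:
  fixes f :: "real \<times> (real ^ 'n) \<Rightarrow> (real ^ 'q) \<Rightarrow> (real ^ 'n)"
    and g :: "'m::finite \<Rightarrow> real \<times> (real ^ 'n) \<Rightarrow> (real ^ 'n)"
    and h :: "real \<times> (real ^ 'n) \<Rightarrow> real"
    and \<Psi> :: "real \<times> (real ^ 'n) \<times> real \<times> (real ^ 'n) \<times> real \<Rightarrow> real"
    and C :: "(real ^ 'm) set" and A :: "(real ^ 'q) set"
    and T0 :: "(real \<times> (real ^ 'n) \<times> real \<times> (real ^ 'n)) set" and K :: ereal
    and S \<pi> \<delta> :: real
    and \<omega>0 y0 \<nu> p0 m0 :: "real \<Rightarrow> real"
    and \<omega> :: "real \<Rightarrow> (real ^ 'm)" and \<alpha> :: "real \<Rightarrow> (real ^ 'q)"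
    and y p m :: "real \<Rightarrow> (real ^ 'n)"
    and \<mu> :: "real measure"
  assumes "K > 0"
    and "closed C" and "convex C" and "cone C"
    and "compact A"
    and "closed T0"
    and "continuous_on (UNIV \<times> A) (\<lambda>(z, a). f z a)"
    and "\<forall>z. \<exists>r>0. \<exists>L. \<forall>a\<in>A. L-lipschitz_on (cball z r) (\<lambda>z'. f z' a)"
    and "\<forall>j. locally_lipschitz (g j)"
    and "locally_lipschitz h"
    and "\<forall>t1 x1 t2 x2. mono (\<lambda>v. \<Psi> (t1, x1, t2, x2, v))"
    and "extended_sense_process f g C A S \<omega>0 \<omega> \<alpha> y0 y \<nu>"
    and "feasible h T0 K S y0 y \<nu>"
    and "\<delta> > 0" and "\<exists>L. L-lipschitz_on (cball (y0 0, y 0, y0 S, y S, \<nu> S) \<delta>) \<Psi>"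
    and "maximum_principle f g h \<Psi> C A T0 K S \<omega>0 \<omega> \<alpha> y0 y \<nu> p0 p \<pi> 0 \<mu> m0 m"
    and "hybrid_subdiff h (y0 0, y 0) \<inter>
           uminus ` (\<lambda>(t1, x1, t2, x2). (t1, x1)) ` limiting_normal_cone T0 (y0 0, y 0, y0 S, y S) = {}"
  shows "(y0 S = y0 0 \<longrightarrow>
            emeasure \<mu> {0<..S} + Linf_norm S (shifted_costate S \<mu> p0 m0)
              + Linf_norm S (shifted_costate S \<mu> p m) \<noteq> 0) \<and>
         (y0 S > y0 0 \<longrightarrow>
            emeasure \<mu> {0<..S} + Linf_norm S (shifted_costate S \<mu> p m) \<noteq> 0)"
proof -
  let ?qt = "shifted_costate S \<mu> p0 m0" and ?qx = "shifted_costate S \<mu> p m"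
  let ?M = "measure \<mu> {0..S}"
  note process = assms(12) and mp = assms(16)
  have \<mu>: "finite_borel_measure_on S \<mu>" and int: "integrable \<mu> m0" "integrable \<mu> m"
    and nontrivial: "Linf_norm S p0 + Linf_norm S p + emeasure \<mu> {0..S} + ennreal 0 \<noteq> 0"
    and hybrid: "AE s in \<mu>. (m0 s, m s) \<in> hybrid_subdiff h (y0 s, y s)"
    using mp[unfolded maximum_principle_def Let_def] by - (elim conjE, assumption)+
  have transversality: "(p0 0, p 0, - ?qt S, - ?qx S, - \<pi>) \<in>
      limiting_normal_cone (endpoint_set T0 K) (y0 0, y 0, y0 S, y S, \<nu> S)"
  proof -
    have "(p0 0, p 0, - ?qt S, - ?qx S, - \<pi>) \<in>
        {a + b | a b. a \<in> scaled_subdiff 0 (limiting_subdiff \<Psi> (y0 0, y 0, y0 S, y S, \<nu> S)) \<and>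
           b \<in> limiting_normal_cone (endpoint_set T0 K) (y0 0, y 0, y0 S, y S, \<nu> S)}"
      using mp[unfolded maximum_principle_def Let_def] by (elim conjE)
    then obtain a b where sum: "(p0 0, p 0, - ?qt S, - ?qx S, - \<pi>) = a + b"
      and a: "a \<in> scaled_subdiff 0 (limiting_subdiff \<Psi> (y0 0, y 0, y0 S, y S, \<nu> S))"
      and b: "b \<in> limiting_normal_cone (endpoint_set T0 K) (y0 0, y 0, y0 S, y S, \<nu> S)"
      by blast
    from a have "a = 0" by (simp add: scaled_subdiff_def)
    with sum b show ?thesis by (simp only: add_0)
  qed
  obtain dp0 dp where W11: "has_W11_deriv S p0 dp0" "has_W11_deriv S p dp"
    using mp[unfolded maximum_principle_def Let_def] by (elim conjE exE)
  interpret finite_measure \<mu>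
    using \<mu> by (simp add: finite_borel_measure_on_def)
  have S: "0 < S"
    using process unfolding extended_sense_process_def by blast
  \<comment> \<open>Both cases of the claim come down to this; they differ in why \<open>p0\<close> equals this constant.\<close>
  have contradiction: False
    if mass: "emeasure \<mu> {0<..S} = 0" and q: "AE s in lebesgue_on {0..S}. ?qx s = 0"
      and p0: "\<And>s. s \<in> {0..S} \<Longrightarrow> p0 s = - (?M *\<^sub>R m0 0)"
  proof -
    have p: "p s = - (?M *\<^sub>R m 0)" if "s \<in> {0..S}" for s
      using costate_eq_if_shifted_costate_AE_0[OF \<mu> mass int(2) W11(2) q S that] .
    have "?M \<noteq> 0"
    proof
      assume M: "?M = 0"
      then have "Linf_norm S p0 = 0" "Linf_norm S p = 0"
        using p0 p by (auto intro!: Linf_norm_eq_0I)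
      then show False
        using nontrivial M by (simp add: emeasure_eq_measure)
    qed
    then have M: "?M > 0"
      by (simp add: zero_less_measure_iff)
    have "?qt S = 0" "?qx S = 0"
      using shifted_costate_if_no_mass_after_0[OF \<mu> mass int(1) S, of p0]
        shifted_costate_if_no_mass_after_0[OF \<mu> mass int(2) S, of p] p0[of S] p[of S] S
      by simp_all
    then have "(- (?M *\<^sub>R m0 0), - (?M *\<^sub>R m 0), 0, 0) \<in>
        limiting_normal_cone T0 (y0 0, y 0, y0 S, y S)"
      using limiting_normal_cone_endpoint_set[OF transversality] p0[of 0] p[of 0] S by simp
    then have "inverse ?M *\<^sub>R (- (?M *\<^sub>R m0 0), - (?M *\<^sub>R m 0), 0, 0) \<in>
        limiting_normal_cone T0 (y0 0, y 0, y0 S, y S)"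
      using M by (intro limiting_normal_cone_scaleR) auto
    then have normal: "(- m0 0, - m 0, 0, 0) \<in> limiting_normal_cone T0 (y0 0, y 0, y0 S, y S)"
      using M by (simp flip: mult.assoc)
    have "AE s in \<mu>. (m0 0, m 0) \<in> hybrid_subdiff h (y0 0, y 0)"
      using hybrid AE_eq_0_if_no_mass_after_0[OF \<mu> mass] by eventually_elim auto
    moreover have "emeasure \<mu> (space \<mu>) \<noteq> 0"
      using M by (simp add: finite_borel_measure_on_simps[OF \<mu>] emeasure_eq_measure)
    ultimately have "(m0 0, m 0) \<in> hybrid_subdiff h (y0 0, y 0)"
      by (simp add: eventually_const_iff ae_filter_eq_bot_iff)
    moreover have "(m0 0, m 0) \<in> uminus ` (\<lambda>(t1, x1, t2, x2). (t1, x1)) `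
        limiting_normal_cone T0 (y0 0, y 0, y0 S, y S)"
      using normal by (intro image_eqI[where x = "(- m0 0, - m 0)"]
          image_eqI[where x = "(- m0 0, - m 0, 0, 0)"]) auto
    ultimately show False
      using assms(17) by blast
  qed
  show ?thesis
  proof (intro conjI impI notI)
    assume "emeasure \<mu> {0<..S} + Linf_norm S ?qt + Linf_norm S ?qx = 0"
    then have mass: "emeasure \<mu> {0<..S} = 0"
      and q: "AE s in lebesgue_on {0..S}. ?qt s = 0" "AE s in lebesgue_on {0..S}. ?qx s = 0"
      by (simp_all add: Linf_norm_eq_0_imp_AE)
    show False
      using contradiction[OF mass q(2)]
        costate_eq_if_shifted_costate_AE_0[OF \<mu> mass int(1) W11(1) q(1) S] by blast
  next
    assume "y0 0 < y0 S" and "emeasure \<mu> {0<..S} + Linf_norm S ?qx = 0"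
    then have mass: "emeasure \<mu> {0<..S} = 0" and q: "AE s in lebesgue_on {0..S}. ?qx s = 0"
      by (simp_all add: Linf_norm_eq_0_imp_AE)
    show False
      using contradiction[OF mass q]
        time_costate_eq_if_shifted_costate_AE_0[OF process mp \<open>cone C\<close> mass q \<open>y0 0 < y0 S\<close>]
      by blast
  qed
qed

end
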